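(* Let $\mathbb{F}$ be a field, $d \ge 2$, $n \ge 1$, and let $T \in \mathsf{T}^d(n)$ satisfy $\mathrm{oprank}(T) < n$. Then $\det(T) = 0$. Equivalently, if $\det(T) \neq 0$ then $\mathrm{oprank}(T) = n$; in particular $\mathrm{rank}(T) \ge n$, and if $d$ is even then $\mathrm{srank}(T) = n$.
   Context: $\mathsf{T}^d(n)$ denotes the set of functions $T:[n]^d \to \mathbb{F}$ ($d$-tensors), $[n]=\{1,\dots,n\}$. The hyperdeterminant of $T\in\mathsf{T}^d(n)$ is $\det(T) = \sum_{\sigma_2,\dots,\sigma_d \in S_n} \mathrm{sgn}(\sigma_2\cdots\sigma_d)\prod_{i=1}^n T(i,\sigma_2(i),\dots,\sigma_d(i))$ (defined for all $d$, odd or even). For a set $\mathsf{S}\subset\mathsf{T}^d(n)$ of "simple" tensors, $\mathrm{rank}_{\mathsf{S}}(T)$ is the minimal $r$ such that $T=\sum_{\ell=1}^r T_\ell$ with all $T_\ell\in\mathsf{S}$ ($\mathrm{rank}_{\mathsf S}(T)=0$ iff $T=0$). Tensor rank $\mathrm{rank}$: simple tensors are $T(i_1,\dots,i_d)=\mathbf v_1(i_1)\cdots\mathbf v_d(i_d)$ with nonzero $\mathbf v_j\in\mathbb F^n$. Slice rank $\mathrm{srank}$: simple tensors are $T(i_1,\dots,i_d)=\mathbf v(i_k)\,T_1(i_1,\dots,i_{k-1},i_{k+1},\dots,i_d)$ for some $k\in[d]$, nonzero $\mathbf v\in\mathbb F^n$ and $T_1\in\mathsf T^{d-1}(n)$.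 Odd partition rank $\mathrm{oprank}$: simple tensors are $T(i_1,\dots,i_d)=T_1(i_{a_1},\dots,i_{a_k})\,T_2(i_{b_1},\dots,i_{b_{d-k}})$ for a partition $\{a_1<\dots<a_k\}\cup\{b_1<\dots<b_{d-k}\}=[d]$ into two nonempty blocks and nonzero $T_1\in\mathsf T^k(n)$, $T_2\in\mathsf T^{d-k}(n)$, where one of the two blocks has odd size and does not contain the element $1$ (the partition may differ between simple tensors). *)

theory Defs
  imports
    "HOL-Library.FuncSet"
    "HOL-Library.Extended_Nat"
    "HOL-Combinatorics.Permutations"
begin

text \<open>
  A tuple \<open>(i\<^sub>1, \<dots>, i\<^sub>d)\<close> in \<open>[n]\<^sup>d\<close> is an extensional function on \<open>{1..d}\<close>. Likewise, vectors and
  tensors are extensional functions on \<open>[n]\<close> and \<open>[n]\<^sup>d\<close>, so that equality of tensors in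
  \<open>tensors d n\<close> is equality of all their entries.
\<close>

definition tuples :: "nat \<Rightarrow> nat \<Rightarrow> (nat \<Rightarrow> nat) set" where
  "tuples d n = {1..d} \<rightarrow>\<^sub>E {1..n}"

definition vectors :: "nat \<Rightarrow> (nat \<Rightarrow> 'a::field) set" where
  "vectors n = {1..n} \<rightarrow>\<^sub>E UNIV"

definition tensors :: "nat \<Rightarrow> nat \<Rightarrow> ((nat \<Rightarrow> nat) \<Rightarrow> 'a::field) set" where
  "tensors d n = tuples d n \<rightarrow>\<^sub>E UNIV"

definition nonzero_vectors :: "nat \<Rightarrow> (nat \<Rightarrow> 'a::field) set" where
  "nonzero_vectors n = {v \<in> vectors n. \<exists>x\<in>{1..n}. v x \<noteq> 0}"

definition nonzero_tensors :: "nat \<Rightarrow> nat \<Rightarrow> ((nat \<Rightarrow> nat) \<Rightarrow> 'a::field) set" where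
  "nonzero_tensors d n = {T \<in> tensors d n. \<exists>i\<in>tuples d n. T i \<noteq> 0}"

text \<open>
  The family \<open>(\<sigma>\<^sub>2, \<dots>, \<sigma>\<^sub>d)\<close> is an extensional function on \<open>{2..d}\<close>; the \<open>foldr\<close> expression is
  the composition \<open>\<sigma>\<^sub>2 \<circ> \<dots> \<circ> \<sigma>\<^sub>d\<close>.
\<close>

definition hyperdet :: "nat \<Rightarrow> nat \<Rightarrow> ((nat \<Rightarrow> nat) \<Rightarrow> 'a::field) \<Rightarrow> 'a" where
  "hyperdet d n T =
     (\<Sum>\<sigma> \<in> {2..d} \<rightarrow>\<^sub>E {p. p permutes {1..n}}.
        of_int (sign (foldr (\<circ>) (map \<sigma> [2..<Suc d]) id)) *
        (\<Prod>i = 1..n. T (\<lambda>k\<in>{1..d}. if k = 1 then i else \<sigma> k i)))"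

text \<open>
  The value is \<open>\<infinity>\<close> if \<open>T\<close> is not a sum of members of \<open>S\<close>.
\<close>

definition rank_wrt ::
  "nat \<Rightarrow> nat \<Rightarrow> ((nat \<Rightarrow> nat) \<Rightarrow> 'a::field) set \<Rightarrow> ((nat \<Rightarrow> nat) \<Rightarrow> 'a) \<Rightarrow> enat" where
  "rank_wrt d n S T =
     Inf {enat r | r. \<exists>X. (\<forall>l\<in>{1..r}. X l \<in> S) \<and> (\<forall>i\<in>tuples d n. T i = (\<Sum>l = 1..r. X l i))}"

definition simple_tensors :: "nat \<Rightarrow> nat \<Rightarrow> ((nat \<Rightarrow> nat) \<Rightarrow> 'a::field) set" where
  "simple_tensors d n =
     {\<lambda>i\<in>tuples d n. \<Prod>j = 1..d. v j (i j) | v. \<forall>j\<in>{1..d}. v j \<in> nonzero_vectors n}"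

definition slice_simple_tensors :: "nat \<Rightarrow> nat \<Rightarrow> ((nat \<Rightarrow> nat) \<Rightarrow> 'a::field) set" where
  "slice_simple_tensors d n =
     {\<lambda>i\<in>tuples d n. v (i k) * T1 (\<lambda>j\<in>{1..d - 1}. if j < k then i j else i (j + 1)) | k v T1.
        k \<in> {1..d} \<and> v \<in> nonzero_vectors n \<and> T1 \<in> nonzero_tensors (d - 1) n}"

text \<open>
  The functions \<open>a\<close> and \<open>b\<close> are the increasing enumerations \<open>a\<^sub>1 < \<dots> < a\<^sub>k\<close> and
  \<open>b\<^sub>1 < \<dots> < b\<^bsub>d-k\<^esub>\<close> of the two blocks.
\<close>

definition odd_partition ::
  "nat \<Rightarrow> nat \<Rightarrow> (nat \<Rightarrow> nat) \<Rightarrow> (nat \<Rightarrow> nat) \<Rightarrow> bool" where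
  "odd_partition d k a b \<longleftrightarrow>
     1 \<le> k \<and> k < d \<and>
     strict_mono_on {1..k} a \<and> strict_mono_on {1..d - k} b \<and>
     a ` {1..k} \<union> b ` {1..d - k} = {1..d} \<and>
     a ` {1..k} \<inter> b ` {1..d - k} = {} \<and>
     (odd k \<and> 1 \<notin> a ` {1..k} \<or> odd (d - k) \<and> 1 \<notin> b ` {1..d - k})"

definition odd_partition_simple_tensors :: "nat \<Rightarrow> nat \<Rightarrow> ((nat \<Rightarrow> nat) \<Rightarrow> 'a::field) set" where
  "odd_partition_simple_tensors d n =
     {\<lambda>i\<in>tuples d n. T1 (\<lambda>j\<in>{1..k}. i (a j)) * T2 (\<lambda>j\<in>{1..d - k}. i (b j)) | k a b T1 T2.
        odd_partition d k a b \<and> T1 \<in> nonzero_tensors k n \<and> T2 \<in> nonzero_tensors (d - k) n}"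

definition tensor_rank :: "nat \<Rightarrow> nat \<Rightarrow> ((nat \<Rightarrow> nat) \<Rightarrow> 'a::field) \<Rightarrow> enat" where
  "tensor_rank d n = rank_wrt d n (simple_tensors d n)"

definition srank :: "nat \<Rightarrow> nat \<Rightarrow> ((nat \<Rightarrow> nat) \<Rightarrow> 'a::field) \<Rightarrow> enat" where
  "srank d n = rank_wrt d n (slice_simple_tensors d n)"

definition oprank :: "nat \<Rightarrow> nat \<Rightarrow> ((nat \<Rightarrow> nat) \<Rightarrow> 'a::field) \<Rightarrow> enat" where
  "oprank d n = rank_wrt d n (odd_partition_simple_tensors d n)"

end

theory Submission imports Defs begin

text \<open>
  If \<open>T = X\<^sub>1 + \<dots> + X\<^sub>r\<close> with \<open>r < n\<close>, expanding the products in the hyperdeterminant gives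
  terms indexed by maps \<open>f : [n] \<rightarrow> [r]\<close>. Each \<open>f\<close> identifies two indices \<open>p \<noteq> q\<close>. Composing
  \<open>\<sigma>\<^sub>k\<close> with the transposition of \<open>p\<close> and \<open>q\<close> for all \<open>k\<close> in the odd block of the simple tensor
  \<open>X\<^bsub>f p\<^esub> = X\<^bsub>f q\<^esub>\<close> preserves the product and reverses the sign. This involution has no fixed
  points, so the terms cancel in every characteristic. The upper bounds come from the
  decomposition of \<open>T\<close> into its \<open>n\<close> slices along the last coordinate, which is a legitimate odd
  block because \<open>d \<ge> 2\<close>.
\<close>

lemma finite_tuples [simp]: "finite (tuples d n)"
  by (simp add: tuples_def finite_PiE)

lemma tuples_reindex:
  assumes "i \<in> tuples d n" and "\<And>j. j \<in> {1..k} \<Longrightarrow> a j \<in> {1..d}"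
  shows "(\<lambda>j\<in>{1..k}. i (a j)) \<in> tuples k n"
  using assms unfolding tuples_def PiE_def Pi_def by auto

subsection \<open>Ranks\<close>

lemma rank_wrt_le:
  assumes "\<And>l. l \<in> {1..r} \<Longrightarrow> X l \<in> S"
    and "\<And>i. i \<in> tuples d n \<Longrightarrow> T i = (\<Sum>l = 1..r. X l i)"
  shows "rank_wrt d n S T \<le> enat r"
  unfolding rank_wrt_def using assms by (intro Inf_lower) blast

lemma rank_wrt_less_enatE:
  assumes "rank_wrt d n S T < enat m"
  obtains r X where "r < m" "\<And>l. l \<in> {1..r} \<Longrightarrow> X l \<in> S"
    "\<And>i. i \<in> tuples d n \<Longrightarrow> T i = (\<Sum>l = 1..r. X l i)"
proof -
  from assms obtain e where
    "e \<in> {enat r | r. \<exists>X. (\<forall>l\<in>{1..r}. X l \<in> S) \<and> (\<forall>i\<in>tuples d n. T i = (\<Sum>l = 1..r. X l i))}"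
    "e < enat m"
    unfolding rank_wrt_def Inf_less_iff by blast
  then obtain r X where "e = enat r" "\<forall>l\<in>{1..r}. X l \<in> S"
    "\<forall>i\<in>tuples d n. T i = (\<Sum>l = 1..r. X l i)"
    by blast
  with \<open>e < enat m\<close> show ?thesis by (intro that[of r X]) auto
qed

lemma rank_wrt_antimono:
  assumes "S \<subseteq> S'"
  shows "rank_wrt d n S' T \<le> rank_wrt d n S T"
  unfolding rank_wrt_def using assms by (intro Inf_superset_mono) blast

text \<open>Simple tensors are nonzero by definition, so a natural decomposition can contain zero
  terms that are not in \<open>S\<close>. Dropping them leaves the sum unchanged and only lowers the
  number of summands.\<close>

lemma rank_wrt_le_card:
  assumes "finite L"
    and S: "\<And>l. l \<in> L \<Longrightarrow> X l \<in> S \<or> (\<forall>i\<in>tuples d n. X l i = 0)"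
    and T: "\<And>i. i \<in> tuples d n \<Longrightarrow> T i = (\<Sum>l\<in>L. X l i)"
  shows "rank_wrt d n S T \<le> enat (card L)"
proof -
  define L' where "L' = {l \<in> L. X l \<in> S}"
  have "finite L'" using \<open>finite L\<close> by (simp add: L'_def)
  then obtain h where h: "bij_betw h {1..card L'} L'"
    using ex_bij_betw_nat_finite_1 by blast
  have "T i = (\<Sum>l = 1..card L'. X (h l) i)" if i: "i \<in> tuples d n" for i
  proof -
    have "T i = (\<Sum>l\<in>L'. X l i)"
      unfolding T[OF i] using S i \<open>finite L\<close>
      by (intro sum.mono_neutral_right) (auto simp: L'_def)
    also have "\<dots> = (\<Sum>l = 1..card L'. X (h l) i)"
      by (rule sum.reindex_bij_betw[OF h, symmetric])
    finally show ?thesis .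
  qed
  moreover have "X (h l) \<in> S" if "l \<in> {1..card L'}" for l
    using bij_betwE[OF h] that by (auto simp: L'_def)
  ultimately have "rank_wrt d n S T \<le> enat (card L')"
    by (intro rank_wrt_le[where X = "\<lambda>l. X (h l)"]) auto
  also have "\<dots> \<le> enat (card L)"
    using \<open>finite L\<close> by (simp add: L'_def card_mono)
  finally show ?thesis .
qed

subsection \<open>Simple tensors\<close>

definition slice_tensor ::
  "nat \<Rightarrow> nat \<Rightarrow> nat \<Rightarrow> (nat \<Rightarrow> 'a::field) \<Rightarrow> ((nat \<Rightarrow> nat) \<Rightarrow> 'a) \<Rightarrow> (nat \<Rightarrow> nat) \<Rightarrow> 'a" where
  "slice_tensor d n k v T1 =
     (\<lambda>i\<in>tuples d n. v (i k) * T1 (\<lambda>j\<in>{1..d - 1}. if j < k then i j else i (j + 1)))"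

text \<open>A class common to all three ranks: it contains the simple tensors, and it lies inside
  the slice-simple and, for \<open>d \<ge> 2\<close>, the odd-partition-simple tensors. A single
  bound for it therefore serves every rank.\<close>

definition last_slice_tensors :: "nat \<Rightarrow> nat \<Rightarrow> ((nat \<Rightarrow> nat) \<Rightarrow> 'a::field) set" where
  "last_slice_tensors d n =
     {slice_tensor d n d v T1 | v T1. v \<in> nonzero_vectors n \<and> T1 \<in> nonzero_tensors (d - 1) n}"

lemma slice_simple_tensors_altdef:
  "slice_simple_tensors d n =
     {slice_tensor d n k v T1 | k v T1.
        k \<in> {1..d} \<and> v \<in> nonzero_vectors n \<and> T1 \<in> nonzero_tensors (d - 1) n}"
  unfolding slice_simple_tensors_def slice_tensor_def ..

lemma last_slice_tensors_subset_slice: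
  "d \<ge> 1 \<Longrightarrow> last_slice_tensors d n \<subseteq> slice_simple_tensors d n"
  unfolding last_slice_tensors_def slice_simple_tensors_altdef by fastforce

text \<open>For \<open>k \<noteq> 1\<close> the odd block avoiding 1 is \<open>{k}\<close>. For
  \<open>k = 1\<close> it is the complement \<open>{2..d}\<close>, whose size \<open>d - 1\<close>
  is odd because \<open>d\<close> is even.\<close>

lemma slice_tensor_in_odd_partition_simple_tensors:
  fixes v :: "nat \<Rightarrow> 'a::field"
  assumes d: "d \<ge> 2" and k: "k \<in> {1..d}" and odd: "k \<noteq> 1 \<or> even d"
    and v: "v \<in> nonzero_vectors n" and T1: "T1 \<in> nonzero_tensors (d - 1) n"
  shows "slice_tensor d n k v T1 \<in> odd_partition_simple_tensors d n"
proof -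
  \<comment> \<open>On \<open>{1..1}\<close> the constant map enumerates \<open>{k}\<close>,
    \<open>b\<close> enumerates the complement by skipping \<open>k\<close>, and \<open>V\<close> is
    the vector \<open>v\<close> read as a 1-tensor.\<close>
  define a where "a = (\<lambda>j::nat. k)"
  define b where "b = (\<lambda>j. if j < k then j else j + 1)"
  define V :: "(nat \<Rightarrow> nat) \<Rightarrow> 'a" where "V = (\<lambda>i\<in>tuples 1 n. v (i 1))"
  have b: "b ` {1..d - 1} = {1..d} - {k}"
  proof
    show "b ` {1..d - 1} \<subseteq> {1..d} - {k}" using k by (auto simp: b_def)
    show "{1..d} - {k} \<subseteq> b ` {1..d - 1}"
    proof
      fix x assume x: "x \<in> {1..d} - {k}"
      have "x = b (if x < k then x else x - 1)" using x by (auto simp: b_def)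
      moreover have "(if x < k then x else x - 1) \<in> {1..d - 1}" using x k by auto
      ultimately show "x \<in> b ` {1..d - 1}" by blast
    qed
  qed
  have "odd_partition d 1 a b"
    unfolding odd_partition_def b using d k odd
    by (auto simp: a_def b_def strict_mono_on_def)
  moreover have "V \<in> nonzero_tensors 1 n"
  proof -
    from v obtain x where x: "x \<in> {1..n}" "v x \<noteq> 0"
      by (auto simp: nonzero_vectors_def)
    have "(\<lambda>j\<in>{1..1}. x) \<in> tuples 1 n" using x by (auto simp: tuples_def)
    moreover from this have "V (\<lambda>j\<in>{1..1}. x) \<noteq> 0" using x by (simp add: V_def)
    moreover have "V \<in> tensors 1 n" unfolding tensors_def V_def by simp
    ultimately show ?thesis unfolding nonzero_tensors_def by blast
  qed
  moreover have "slice_tensor d n k v T1 =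
    (\<lambda>i\<in>tuples d n. V (\<lambda>j\<in>{1..1}. i (a j)) * T1 (\<lambda>j\<in>{1..d - 1}. i (b j)))"
    unfolding slice_tensor_def
  proof (rule restrict_ext)
    fix i assume i: "i \<in> tuples d n"
    have "(\<lambda>j\<in>{1..1}. i (a j)) \<in> tuples 1 n"
      using k by (intro tuples_reindex[OF i]) (auto simp: a_def)
    hence "V (\<lambda>j\<in>{1..1}. i (a j)) = v (i k)" by (simp add: V_def a_def)
    moreover have "(\<lambda>j\<in>{1..d - 1}. if j < k then i j else i (j + 1)) = (\<lambda>j\<in>{1..d - 1}. i (b j))"
      by (auto simp: b_def)
    ultimately show "v (i k) * T1 (\<lambda>j\<in>{1..d - 1}. if j < k then i j else i (j + 1)) =
        V (\<lambda>j\<in>{1..1}. i (a j)) * T1 (\<lambda>j\<in>{1..d - 1}. i (b j))" by simp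
  qed
  ultimately show ?thesis
    unfolding odd_partition_simple_tensors_def using T1 by blast
qed

lemma last_slice_tensors_subset_odd_partition:
  "d \<ge> 2 \<Longrightarrow> last_slice_tensors d n \<subseteq> odd_partition_simple_tensors d n"
  unfolding last_slice_tensors_def
  by (auto intro!: slice_tensor_in_odd_partition_simple_tensors)

lemma slice_simple_tensors_subset_odd_partition:
  "d \<ge> 2 \<Longrightarrow> even d \<Longrightarrow> slice_simple_tensors d n \<subseteq> odd_partition_simple_tensors d n"
  unfolding slice_simple_tensors_altdef
  by (auto intro!: slice_tensor_in_odd_partition_simple_tensors)

text \<open>Split off the last factor. The product of the others is a nonzero tensor because a field
  has no zero divisors: it does not vanish at a tuple whose coordinates are points where the
  respective vectors are nonzero.\<close>

lemma simple_tensors_subset_last_slice: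
  assumes "d \<ge> 1"
  shows "simple_tensors d n \<subseteq> (last_slice_tensors d n :: ((nat \<Rightarrow> nat) \<Rightarrow> 'a::field) set)"
proof
  fix X :: "(nat \<Rightarrow> nat) \<Rightarrow> 'a"
  assume "X \<in> simple_tensors d n"
  then obtain v where X: "X = (\<lambda>i\<in>tuples d n. \<Prod>j = 1..d. v j (i j))"
    and v: "\<And>j. j \<in> {1..d} \<Longrightarrow> v j \<in> nonzero_vectors n"
    unfolding simple_tensors_def by blast
  define T1 where "T1 = (\<lambda>i\<in>tuples (d - 1) n. \<Prod>j = 1..d - 1. v j (i j))"
  have "\<forall>j\<in>{1..d}. \<exists>x. x \<in> {1..n} \<and> v j x \<noteq> 0"
    using v by (fastforce simp: nonzero_vectors_def)
  then obtain x where x: "\<And>j. j \<in> {1..d} \<Longrightarrow> x j \<in> {1..n} \<and> v j (x j) \<noteq> 0"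
    by metis
  have "restrict x {1..d - 1} \<in> tuples (d - 1) n"
    using x by (force simp: tuples_def)
  moreover from this have "T1 (restrict x {1..d - 1}) \<noteq> 0"
    using x by (auto simp: T1_def)
  moreover have "T1 \<in> tensors (d - 1) n" by (simp add: T1_def tensors_def)
  ultimately have "T1 \<in> nonzero_tensors (d - 1) n" unfolding nonzero_tensors_def by blast
  moreover have "X = slice_tensor d n d (v d) T1"
    unfolding X slice_tensor_def
  proof (rule restrict_ext)
    fix i assume i: "i \<in> tuples d n"
    have eq: "(\<lambda>j\<in>{1..d - 1}. if j < d then i j else i (j + 1)) = (\<lambda>j\<in>{1..d - 1}. i j)"
      by (rule restrict_ext) auto
    have "(\<lambda>j\<in>{1..d - 1}. i j) \<in> tuples (d - 1) n"
      by (intro tuples_reindex[OF i]) auto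
    hence "T1 (\<lambda>j\<in>{1..d - 1}. i j) = (\<Prod>j = 1..d - 1. v j (i j))"
      by (simp add: T1_def)
    moreover have "{1..d} = insert d {1..d - 1}" using assms by auto
    ultimately show "(\<Prod>j = 1..d. v j (i j)) =
        v d (i d) * T1 (\<lambda>j\<in>{1..d - 1}. if j < d then i j else i (j + 1))"
      unfolding eq using assms by simp
  qed
  ultimately show "X \<in> last_slice_tensors d n"
    unfolding last_slice_tensors_def using v assms by force
qed

text \<open>\<open>T\<close> is the sum over \<open>m\<close> of its slice at last coordinate
  \<open>m\<close> times the \<open>m\<close>-th standard basis vector in that coordinate.\<close>

lemma rank_wrt_last_slice_tensors_le:
  fixes T :: "(nat \<Rightarrow> nat) \<Rightarrow> 'a::field"
  assumes "d \<ge> 1"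
  shows "rank_wrt d n (last_slice_tensors d n) T \<le> enat n"
proof -
  define v where "v m = (\<lambda>x\<in>{1..n}. if x = m then 1 else 0 :: 'a)" for m
  define T1 where "T1 m = (\<lambda>i\<in>tuples (d - 1) n. T (i(d := m)))" for m
  define X where "X m = slice_tensor d n d (v m) (T1 m)" for m
  have X: "X m i = (if i d = m then T i else 0)" if i: "i \<in> tuples d n" for m i
  proof -
    define i' where "i' = (\<lambda>j\<in>{1..d - 1}. i j)"
    have eq: "(\<lambda>j\<in>{1..d - 1}. if j < d then i j else i (j + 1)) = i'"
      unfolding i'_def by (rule restrict_ext) auto
    have "i' \<in> tuples (d - 1) n"
      unfolding i'_def by (intro tuples_reindex[OF i]) auto
    \<comment> \<open>This is an equality of functions on all of \<open>nat\<close>: outside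
      \<open>{1..d}\<close> both sides are \<open>undefined\<close> by extensionality.\<close>
    moreover have "i'(d := i d) = i"
    proof
      fix j
      show "(i'(d := i d)) j = i j"
        using i PiE_arb[of i "{1..d}" "\<lambda>_. {1..n}" j] by (auto simp: i'_def tuples_def)
    qed
    moreover have "i d \<in> {1..n}" using i assms by (auto simp: tuples_def)
    ultimately show ?thesis
      unfolding X_def slice_tensor_def restrict_apply'[OF i] eq by (auto simp: v_def T1_def)
  qed
  have "rank_wrt d n (last_slice_tensors d n) T \<le> enat (card {1..n})"
  proof (rule rank_wrt_le_card[where X = X])
    fix m assume m: "m \<in> {1..n}"
    have "v m \<in> nonzero_vectors n"
      using m by (auto simp: v_def nonzero_vectors_def vectors_def)
    moreover have "T1 m \<in> tensors (d - 1) n" by (simp add: T1_def tensors_def)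
    ultimately have "X m \<in> last_slice_tensors d n" if "\<exists>i\<in>tuples (d - 1) n. T1 m i \<noteq> 0"
      using that unfolding X_def last_slice_tensors_def nonzero_tensors_def by blast
    \<comment> \<open>A vanishing slice is not simple, but it contributes a zero term, which
      \<open>rank_wrt_le_card\<close> allows.\<close>
    moreover have "X m i = 0" if "\<forall>i\<in>tuples (d - 1) n. T1 m i = 0" "i \<in> tuples d n" for i
    proof -
      have "(\<lambda>j\<in>{1..d - 1}. i (if j < d then j else j + 1)) \<in> tuples (d - 1) n"
        using that by (intro tuples_reindex[of i d]) auto
      hence "T1 m (\<lambda>j\<in>{1..d - 1}. if j < d then i j else i (j + 1)) = 0"
        using that(1) by (simp add: if_distrib)
      thus ?thesis using that(2) by (simp add: X_def slice_tensor_def)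
    qed
    ultimately show "X m \<in> last_slice_tensors d n \<or> (\<forall>i\<in>tuples d n. X m i = 0)" by blast
  next
    fix i assume i: "i \<in> tuples d n"
    hence "i d \<in> {1..n}" using assms by (auto simp: tuples_def)
    thus "T i = (\<Sum>m\<in>{1..n}. X m i)" by (simp add: X[OF i])
  qed auto
  thus ?thesis by simp
qed

text \<open>One factor of \<open>X\<close> sees only the coordinates in \<open>A\<close>, the other
  only those outside. Exchanging the \<open>A\<close>-coordinates of two tuples hence just permutes
  the four factors. Avoiding 1 places \<open>A\<close> among the coordinates governed by
  permutations.\<close>

lemma odd_partition_simple_tensor_exchange:
  assumes "X \<in> odd_partition_simple_tensors d n"
  obtains A where "A \<subseteq> {2..d}" "odd (card A)"
    "\<And>i j. i \<in> tuples d n \<Longrightarrow> j \<in> tuples d n \<Longrightarrow>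
       X (override_on i j A) * X (override_on j i A) = X i * X j"
proof -
  from assms obtain k a b T1 T2 where
    X: "X = (\<lambda>i\<in>tuples d n. T1 (\<lambda>j\<in>{1..k}. i (a j)) * T2 (\<lambda>j\<in>{1..d - k}. i (b j)))"
    and ab: "odd_partition d k a b"
    unfolding odd_partition_simple_tensors_def by blast
  define A B where "A = a ` {1..k}" and "B = b ` {1..d - k}"
  have union: "A \<union> B = {1..d}" and disj: "A \<inter> B = {}"
    and odd: "odd k \<and> 1 \<notin> A \<or> odd (d - k) \<and> 1 \<notin> B"
    using ab by (auto simp: odd_partition_def A_def B_def)
  have card: "card A = k" "card B = d - k"
    using ab unfolding odd_partition_def A_def B_def
    by (auto dest!: strict_mono_on_imp_inj_on simp: card_image)
  have sep: "a x \<in> A" "a x \<notin> B" if "x \<in> {1..k}" for x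
    using disj that unfolding A_def B_def by blast+
  have sep': "b x \<in> B" "b x \<notin> A" if "x \<in> {1..d - k}" for x
    using disj that unfolding A_def B_def by blast+
  have over: "override_on i j C \<in> tuples d n"
    if "i \<in> tuples d n" "j \<in> tuples d n" for i j C
    using that by (auto simp: tuples_def override_on_def PiE_iff extensional_def)
  \<comment> \<open>Either block may be the odd one, so the identity is proved for both: here the
    \<open>T1\<close> factors trade places, for \<open>B\<close> the \<open>T2\<close>
    factors.\<close>
  have A: "X (override_on i j A) * X (override_on j i A) = X i * X j"
    if ij: "i \<in> tuples d n" "j \<in> tuples d n" for i j
  proof -
    have "(\<lambda>m\<in>{1..k}. override_on x y A (a m)) = (\<lambda>m\<in>{1..k}. y (a m))"
      "(\<lambda>m\<in>{1..d - k}. override_on x y A (b m)) = (\<lambda>m\<in>{1..d - k}. x (b m))"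
      for x y :: "nat \<Rightarrow> nat"
      using sep sep' by (auto simp: override_on_def intro!: restrict_ext)
    thus ?thesis using ij over[OF ij] over[OF ij(2,1)] by (simp add: X)
  qed
  have B: "X (override_on i j B) * X (override_on j i B) = X i * X j"
    if ij: "i \<in> tuples d n" "j \<in> tuples d n" for i j
  proof -
    have "(\<lambda>m\<in>{1..k}. override_on x y B (a m)) = (\<lambda>m\<in>{1..k}. x (a m))"
      "(\<lambda>m\<in>{1..d - k}. override_on x y B (b m)) = (\<lambda>m\<in>{1..d - k}. y (b m))"
      for x y :: "nat \<Rightarrow> nat"
      using sep sep' by (auto simp: override_on_def intro!: restrict_ext)
    thus ?thesis using ij over[OF ij] over[OF ij(2,1)] by (simp add: X)
  qed
  have *: "C \<subseteq> {2..d}" if "1 \<notin> C" "C \<subseteq> {1..d}" for C :: "nat set"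
  proof
    fix x assume "x \<in> C"
    with that have "x \<noteq> 1" "x \<in> {1..d}" by auto
    thus "x \<in> {2..d}" by simp
  qed
  from odd show ?thesis
  proof
    assume "odd k \<and> 1 \<notin> A"
    thus ?thesis using * union card A by (intro that[of A]) auto
  next
    assume "odd (d - k) \<and> 1 \<notin> B"
    thus ?thesis using * union card B by (intro that[of B]) auto
  qed
qed

subsection \<open>Vanishing of the hyperdeterminant\<close>

text \<open>The first conjunct strengthens the induction: multiplicativity of \<open>sign\<close>
  requires both composed maps to be permutations.\<close>

lemma sign_foldr_comp:
  assumes "\<And>k. k \<in> set ks \<Longrightarrow> permutation (\<sigma> k)"
  shows "permutation (foldr (\<circ>) (map \<sigma> ks) id) \<and>
    sign (foldr (\<circ>) (map \<sigma> ks) id) = (\<Prod>k\<leftarrow>ks. sign (\<sigma> k))"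
  using assms by (induction ks) (auto simp: sign_compose permutation_compose)

text \<open>Coordinate 1 acts as if its permutation were the identity, so changing \<sigma> cannot
  affect it. This is why the odd block has to avoid 1.\<close>

definition entry :: "nat \<Rightarrow> (nat \<Rightarrow> nat \<Rightarrow> nat) \<Rightarrow> nat \<Rightarrow> nat \<Rightarrow> nat" where
  "entry d \<sigma> i = (\<lambda>k\<in>{1..d}. if k = 1 then i else \<sigma> k i)"

lemma entry_in_tuples:
  assumes "\<sigma> \<in> {2..d} \<rightarrow>\<^sub>E {p. p permutes {1..n}}" "i \<in> {1..n}"
  shows "entry d \<sigma> i \<in> tuples d n"
proof -
  have "\<sigma> k i \<in> {1..n}" if "k \<in> {1..d}" "k \<noteq> 1" for k
  proof -
    have "\<sigma> k permutes {1..n}" using assms(1) that by (auto simp: PiE_iff)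
    thus ?thesis using assms(2) permutes_in_image by metis
  qed
  thus ?thesis using assms(2) by (auto simp: entry_def tuples_def)
qed

lemma hyperdet_altdef:
  "hyperdet d n T = (\<Sum>\<sigma> \<in> {2..d} \<rightarrow>\<^sub>E {p. p permutes {1..n}}.
     of_int (\<Prod>k = 2..d. sign (\<sigma> k)) * (\<Prod>i = 1..n. T (entry d \<sigma> i)))"
  unfolding hyperdet_def entry_def
proof (rule sum.cong[OF refl])
  fix \<sigma> assume \<sigma>: "\<sigma> \<in> {2..d} \<rightarrow>\<^sub>E {p. p permutes {1..n}}"
  have "permutation (\<sigma> k)" if "k \<in> set [2..<Suc d]" for k
    using \<sigma> that by (auto intro!: permutes_imp_permutation[of "{1..n}"] simp: PiE_iff)
  hence "sign (foldr (\<circ>) (map \<sigma> [2..<Suc d]) id) = (\<Prod>k\<leftarrow>[2..<Suc d]. sign (\<sigma> k))"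
    using sign_foldr_comp by blast
  also have "\<dots> = (\<Prod>k = 2..d. sign (\<sigma> k))"
    by (subst prod.distinct_set_conv_list[symmetric])
      (simp_all del: upt_Suc add: atLeastLessThanSuc_atLeastAtMost)
  finally show "of_int (sign (foldr (\<circ>) (map \<sigma> [2..<Suc d]) id)) *
      (\<Prod>i = 1..n. T (\<lambda>k\<in>{1..d}. if k = 1 then i else \<sigma> k i)) =
    of_int (\<Prod>k = 2..d. sign (\<sigma> k)) *
      (\<Prod>i = 1..n. T (\<lambda>k\<in>{1..d}. if k = 1 then i else \<sigma> k i))" by simp
qed

text \<open>Sign reversal alone gives only that twice the sum is zero, which says nothing in
  characteristic 2. The predicate \<open>P\<close> cuts \<open>S\<close> into two halves
  interchanged by \<open>\<phi>\<close>, whose sums cancel term by term.\<close>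

lemma sum_sign_reversing_eq_0:
  fixes w :: "'b \<Rightarrow> 'a::ab_group_add"
  assumes "finite S" and "\<And>x. x \<in> S \<Longrightarrow> \<phi> x \<in> S" and "\<And>x. x \<in> S \<Longrightarrow> \<phi> (\<phi> x) = x"
    and "\<And>x. x \<in> S \<Longrightarrow> P (\<phi> x) \<longleftrightarrow> \<not> P x" and w: "\<And>x. x \<in> S \<Longrightarrow> w (\<phi> x) = - w x"
  shows "sum w S = 0"
proof -
  have "sum w {x \<in> S. \<not> P x} = (\<Sum>x \<in> {x \<in> S. P x}. - w x)"
    by (rule sum.reindex_bij_witness[of _ \<phi> \<phi>]) (auto simp: assms)
  moreover have "sum w S = sum w {x \<in> S. P x} + sum w {x \<in> S. \<not> P x}"
    using \<open>finite S\<close> by (subst sum.union_disjoint[symmetric]) (auto intro!: sum.cong)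
  ultimately show ?thesis by (simp add: sum_negf)
qed

text \<open>\<open>X\<close> is indexed by positions in \<open>[n]\<close>, standing for the summand
  chosen at each position; \<open>X p = X q\<close> records a collision of choices.\<close>

lemma alternating_sum_eq_0:
  fixes X :: "nat \<Rightarrow> (nat \<Rightarrow> nat) \<Rightarrow> 'a::field"
  assumes A: "A \<subseteq> {2..d}" "odd (card A)"
    and ex: "\<And>i j. i \<in> tuples d n \<Longrightarrow> j \<in> tuples d n \<Longrightarrow>
       X p (override_on i j A) * X p (override_on j i A) = X p i * X p j"
    and pq: "p \<in> {1..n}" "q \<in> {1..n}" "p \<noteq> q" "X p = X q"
  shows "(\<Sum>\<sigma> \<in> {2..d} \<rightarrow>\<^sub>E {p. p permutes {1..n}}.
    of_int (\<Prod>k = 2..d. sign (\<sigma> k)) * (\<Prod>i = 1..n. X i (entry d \<sigma> i))) = 0"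
proof -
  define S where "S = {2..d} \<rightarrow>\<^sub>E {p. p permutes {1..n}}"
  define \<tau> where "\<tau> = transpose p q"
  define \<phi> where "\<phi> \<sigma> = (\<lambda>k\<in>{2..d}. if k \<in> A then \<sigma> k \<circ> \<tau> else \<sigma> k)" for \<sigma> :: "nat \<Rightarrow> nat \<Rightarrow> nat"
  \<comment> \<open>Odd cardinality makes \<open>A\<close> nonempty. The sign of the permutation at
    this fixed coordinate is flipped by \<open>\<phi>\<close> and serves as the separating
    predicate.\<close>
  obtain a where a: "a \<in> A" using A(2) by fastforce
  have \<tau>: "\<tau> permutes {1..n}" "sign \<tau> = -1" "\<tau> \<circ> \<tau> = id"
    using pq by (auto simp: \<tau>_def permutes_swap_id sign_swap_id)
  have perm: "\<sigma> k permutes {1..n}" if "\<sigma> \<in> S" "k \<in> {2..d}" for \<sigma> k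
    using that by (auto simp: S_def PiE_iff)
  have sgn: "sign (\<phi> \<sigma> k) = (if k \<in> A then - 1 else 1) * sign (\<sigma> k)"
    if "\<sigma> \<in> S" "k \<in> {2..d}" for \<sigma> k
    using that perm[OF that] \<tau>
    by (auto simp: \<phi>_def sign_compose permutes_imp_permutation[of "{1..n}"])
  have sgn_ne: "sign \<pi> = 1 \<longleftrightarrow> \<not> sign \<pi> = -1" for \<pi> :: "nat \<Rightarrow> nat"
    by (auto simp: sign_def)
  have "(\<Sum>\<sigma> \<in> S. of_int (\<Prod>k = 2..d. sign (\<sigma> k)) * (\<Prod>i = 1..n. X i (entry d \<sigma> i))) = 0"
  proof (rule sum_sign_reversing_eq_0[where \<phi> = \<phi> and P = "\<lambda>\<sigma>. sign (\<sigma> a) = 1"])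
    show "finite S" by (simp add: S_def finite_PiE finite_permutations)
  next
    fix \<sigma> assume \<sigma>: "\<sigma> \<in> S"
    show "\<phi> \<sigma> \<in> S"
      using perm[OF \<sigma>] \<tau>(1) by (auto simp: S_def \<phi>_def intro!: permutes_compose)
    show "\<phi> (\<phi> \<sigma>) = \<sigma>"
    proof
      fix k
      show "\<phi> (\<phi> \<sigma>) k = \<sigma> k"
        using \<sigma> \<tau>(3) by (auto simp: \<phi>_def comp_assoc S_def PiE_iff extensional_def)
    qed
    show "(sign (\<phi> \<sigma> a) = 1) = (\<not> sign (\<sigma> a) = 1)"
      using sgn[OF \<sigma>, of a] a A(1) sgn_ne[of "\<sigma> a"] by auto
    have "(\<Prod>k = 2..d. sign (\<phi> \<sigma> k)) =
        (\<Prod>k = 2..d. if k \<in> A then - 1 else 1) * (\<Prod>k = 2..d. sign (\<sigma> k))"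
      using sgn[OF \<sigma>] by (simp add: prod.distrib[symmetric])
    also have "(\<Prod>k = 2..d. if k \<in> A then - 1 else 1 :: int) = (\<Prod>k\<in>A. - 1)"
      using A(1) by (intro prod.mono_neutral_cong_right) auto
    also have "\<dots> = - 1" using A(2) by simp
    finally have signs: "(\<Prod>k = 2..d. sign (\<phi> \<sigma> k)) = - (\<Prod>k = 2..d. sign (\<sigma> k))" by simp
    \<comment> \<open>At positions \<open>p\<close> and \<open>q\<close> this is exactly the
      exchange of \<open>A\<close>-coordinates in \<open>ex\<close>; every other position is fixed
      by \<open>\<tau>\<close> and keeps its entry.\<close>
    have ent: "entry d (\<phi> \<sigma>) i = override_on (entry d \<sigma> i) (entry d \<sigma> (\<tau> i)) A" for i
      using A(1) by (auto simp: entry_def \<phi>_def override_on_def fun_eq_iff)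
    have split: "(\<Prod>i = 1..n. g i) = g p * g q * prod g ({1..n} - {p, q})" for g :: "nat \<Rightarrow> 'a"
    proof -
      have "prod g {1..n} = g p * prod g ({1..n} - {p})"
        using pq by (intro prod.remove) auto
      also have "prod g ({1..n} - {p}) = g q * prod g ({1..n} - {p} - {q})"
        using pq by (intro prod.remove) auto
      also have "{1..n} - {p} - {q} = {1..n} - {p, q}" by auto
      finally show ?thesis by (simp add: mult_ac)
    qed
    have "X p (entry d (\<phi> \<sigma>) p) * X q (entry d (\<phi> \<sigma>) q) =
        X p (entry d \<sigma> p) * X q (entry d \<sigma> q)"
      using ex[OF entry_in_tuples entry_in_tuples, of \<sigma> p \<sigma> q] pq \<sigma>
      by (simp add: ent \<tau>_def S_def)
    moreover have "X i (entry d (\<phi> \<sigma>) i) = X i (entry d \<sigma> i)" if "i \<in> {1..n} - {p, q}" for i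
      using that by (simp add: ent \<tau>_def transpose_def override_on_def)
    ultimately have "(\<Prod>i = 1..n. X i (entry d (\<phi> \<sigma>) i)) = (\<Prod>i = 1..n. X i (entry d \<sigma> i))"
      by (simp only: split cong: prod.cong)
    thus "of_int (\<Prod>k = 2..d. sign (\<phi> \<sigma> k)) * (\<Prod>i = 1..n. X i (entry d (\<phi> \<sigma>) i)) =
        - (of_int (\<Prod>k = 2..d. sign (\<sigma> k)) * (\<Prod>i = 1..n. X i (entry d \<sigma> i)))"
      by (simp only: signs of_int_minus mult_minus_left)
  qed
  thus ?thesis by (simp add: S_def)
qed

lemma hyperdet_eq_0_if_oprank_less:
  fixes T :: "(nat \<Rightarrow> nat) \<Rightarrow> 'a::field"
  assumes "oprank d n T < enat n"
  shows "hyperdet d n T = 0"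
proof -
  define S where "S = {2..d} \<rightarrow>\<^sub>E {p. p permutes {1..n}}"
  from assms obtain r X where r: "r < n"
    and X: "\<And>l. l \<in> {1..r} \<Longrightarrow> X l \<in> odd_partition_simple_tensors d n"
    and T: "\<And>i. i \<in> tuples d n \<Longrightarrow> T i = (\<Sum>l = 1..r. X l i)"
    unfolding oprank_def by (rule rank_wrt_less_enatE) blast
  \<comment> \<open>A function in \<open>F\<close> chooses one summand of \<open>T\<close> for each
    position when the product of sums is expanded.\<close>
  define F where "F = {1..n} \<rightarrow>\<^sub>E {1..r}"
  have "hyperdet d n T = (\<Sum>\<sigma>\<in>S. \<Sum>f\<in>F.
      of_int (\<Prod>k = 2..d. sign (\<sigma> k)) * (\<Prod>i = 1..n. X (f i) (entry d \<sigma> i)))"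
    unfolding hyperdet_altdef S_def[symmetric]
  proof (rule sum.cong[OF refl])
    fix \<sigma> assume "\<sigma> \<in> S"
    hence "(\<Prod>i = 1..n. T (entry d \<sigma> i)) = (\<Prod>i = 1..n. \<Sum>l = 1..r. X l (entry d \<sigma> i))"
      by (intro prod.cong refl T entry_in_tuples) (auto simp: S_def)
    also have "\<dots> = (\<Sum>f\<in>F. \<Prod>i = 1..n. X (f i) (entry d \<sigma> i))"
      unfolding F_def by (rule prod_sum_PiE) auto
    finally show "of_int (\<Prod>k = 2..d. sign (\<sigma> k)) * (\<Prod>i = 1..n. T (entry d \<sigma> i)) =
      (\<Sum>f\<in>F. of_int (\<Prod>k = 2..d. sign (\<sigma> k)) * (\<Prod>i = 1..n. X (f i) (entry d \<sigma> i)))"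
      by (simp only: sum_distrib_left)
  qed
  \<comment> \<open>The collision \<open>p\<close>, \<open>q\<close> and the odd block depend on
    \<open>f\<close>, so the cancellation over \<sigma> is carried out for each \<open>f\<close>
    separately.\<close>
  also have "\<dots> = (\<Sum>f\<in>F. \<Sum>\<sigma>\<in>S.
      of_int (\<Prod>k = 2..d. sign (\<sigma> k)) * (\<Prod>i = 1..n. X (f i) (entry d \<sigma> i)))"
    by (rule sum.swap)
  also have "\<dots> = 0"
  proof (rule sum.neutral, rule ballI)
    fix f assume f: "f \<in> F"
    have fr: "f ` {1..n} \<subseteq> {1..r}" using f by (auto simp: F_def)
    hence "card (f ` {1..n}) \<le> card {1..r}" by (intro card_mono) auto
    hence "\<not> inj_on f {1..n}" using r by (intro pigeonhole) simp
    then obtain p q where pq: "p \<in> {1..n}" "q \<in> {1..n}" "p \<noteq> q" "f p = f q"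
      by (auto simp: inj_on_def)
    have "f p \<in> {1..r}" using fr pq(1) by blast
    from odd_partition_simple_tensor_exchange[OF X[OF this]] obtain A where
      "A \<subseteq> {2..d}" "odd (card A)"
      "\<And>i j. i \<in> tuples d n \<Longrightarrow> j \<in> tuples d n \<Longrightarrow>
        X (f p) (override_on i j A) * X (f p) (override_on j i A) = X (f p) i * X (f p) j"
      by blast
    thus "(\<Sum>\<sigma>\<in>S. of_int (\<Prod>k = 2..d. sign (\<sigma> k)) * (\<Prod>i = 1..n. X (f i) (entry d \<sigma> i))) = 0"
      unfolding S_def using pq
      by (intro alternating_sum_eq_0[of A d n "\<lambda>i. X (f i)" p q]) auto
  qed
  finally show ?thesis .
qed

section \<open>Comparison of the three ranks\<close>

theorem theorem4p3:
  fixes T :: "(nat \<Rightarrow> nat) \<Rightarrow> 'a::field" and d n :: nat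
  assumes "d \<ge> 2" and "n \<ge> 1" and "T \<in> tensors d n"
  shows "(oprank d n T < enat n \<longrightarrow> hyperdet d n T = 0) \<and>
    (hyperdet d n T \<noteq> 0 \<longrightarrow>
       oprank d n T = enat n \<and>
       tensor_rank d n T \<ge> enat n \<and>
       (even d \<longrightarrow> srank d n T = enat n))"
proof (intro conjI impI)
  assume "oprank d n T < enat n"
  thus "hyperdet d n T = 0" by (rule hyperdet_eq_0_if_oprank_less)
next
  assume "hyperdet d n T \<noteq> 0"
  hence lower: "enat n \<le> oprank d n T"
    using hyperdet_eq_0_if_oprank_less not_less by blast
  have d: "d \<ge> 1" using assms by simp
  \<comment> \<open>The last-slice rank is squeezed between \<open>oprank d n T\<close>, at least
    \<open>n\<close> by contraposition, and \<open>n\<close>. A larger class of summands gives a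
    smaller rank, so the class inclusions carry these bounds to the other ranks.\<close>
  note upper = rank_wrt_last_slice_tensors_le[OF d, of n T]
  have last: "oprank d n T \<le> rank_wrt d n (last_slice_tensors d n) T"
    unfolding oprank_def
    by (intro rank_wrt_antimono last_slice_tensors_subset_odd_partition assms)
  show "oprank d n T = enat n"
    using lower last upper by simp
  have "rank_wrt d n (last_slice_tensors d n) T \<le> tensor_rank d n T"
    unfolding tensor_rank_def by (intro rank_wrt_antimono simple_tensors_subset_last_slice d)
  thus "enat n \<le> tensor_rank d n T"
    using lower last by (meson order_trans)
  assume "even d"
  hence "oprank d n T \<le> srank d n T"
    unfolding oprank_def srank_def
    by (intro rank_wrt_antimono slice_simple_tensors_subset_odd_partition assms)
  moreover have "srank d n T \<le> rank_wrt d n (last_slice_tensors d n) T"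
    unfolding srank_def by (intro rank_wrt_antimono last_slice_tensors_subset_slice d)
  ultimately show "srank d n T = enat n"
    using lower upper by (meson order_antisym order_trans)
qed

end
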